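(* Let $\mathcal{X}\subset\mathbb{R}^d$, $A\subset\mathbb{R}^m$ be finite (nonempty), $r:\mathcal{X}\times A\times\mathcal{X}\to\mathbb{R}$, $\alpha\in(0,1)$. Let $(x,a)\mapsto\mathcal{P}(x,a)\subseteq\mathcal{M}_1(\mathcal{X})$ be a (possibly infinite) ambiguity set such that the set-valued map $\mathcal{X}\times A\ni(x,a)\twoheadrightarrow\mathcal{P}(x,a)$ is nonempty, compact-valued and continuous (i.e. upper and lower hemicontinuous) in the weak topology. Suppose there is a sequence of finite ambiguity sets $\mathcal{P}^{(n)}(x,a)\subset\mathcal{P}(x,a)$, $n\in\mathbb{N}$, such that for all $(x,a)\in\mathcal{X}\times A$ and all $\mathbb{P}\in\mathcal{P}(x,a)$ there exists a sequence $(\mathbb{P}^{(n)})_{n\in\mathbb{N}}$ with $\mathbb{P}^{(n)}\in\mathcal{P}^{(n)}(x,a)$ for all $n$ and $$\mathbb{P}^{(n)}\to\mathbb{P}\ \text{weakly, and}\ \int_{\mathcal{X}}|x|\,d\mathbb{P}^{(n)}(x)\to\int_{\mathcal{X}}|x|\,d\mathbb{P}(x)\quad\text{as }n\to\infty.$$ Let $V$ and $V^{(n)}$ be the robust value functions associated with $\mathcal{P}$ and $\mathcal{P}^{(n)}$, respectively. Then for all $(x,a)\in\mathcal{X}\times A$, $$\lim_{n\to\infty}\ \inf_{\mathbb{P}\in\mathcal{P}^{(n)}(x,a)}\mathbb{E}_{\mathbb{P}}\big[r(x,a,X_1)+\alpha V^{(n)}(X_1)\big]=\inf_{\mathbb{P}\in\mathcal{P}(x,a)}\mathbb{E}_{\mathbb{P}}\big[r(x,a,X_1)+\alpha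 V(X_1)\big],$$ i.e. $\lim_{n\to\infty}Q^{(n)*}(x,a)=Q^*(x,a)$, where $Q^{(n)*}(x,a)$ and $Q^*(x,a)$ denote the two infima.
   Context: $\mathcal{M}_1(\mathcal{X})$ is the set of probability measures on $\mathcal{X}$; $|x|$ is the Euclidean norm. For an ambiguity set $\mathcal{R}$, i.e. an assignment $(x,a)\mapsto\mathcal{R}(x,a)\subseteq\mathcal{M}_1(\mathcal{X})$, the associated robust value function is $$V^{\mathcal{R}}(x)=\sup_{\mathbf{a}\in\mathcal{A}}\inf_{\mathbb{P}\in\mathfrak{P}_{x,\mathbf{a}}}\mathbb{E}_{\mathbb{P}}\Big[\sum_{t=0}^\infty\alpha^tr(X_t,a_t(X_t),X_{t+1})\Big],\qquad x\in\mathcal{X},$$ where $\mathcal{A}$ is the set of policies $\mathbf{a}=(a_t)_{t\ge0}$ with $a_t:\mathcal{X}\to A$, and $\mathfrak{P}_{x,\mathbf{a}}$ is the set of laws $\delta_x\otimes\mathbb{P}_0\otimes\mathbb{P}_1\otimes\cdots$ of processes $(X_t)_{t\ge0}$ on $\mathcal{X}$ ($X_0=x$, and $X_{t+1}$ has conditional law $\mathbb{P}_t(X_t)$ given $X_0,\dots,X_t$) with kernels $\mathbb{P}_t:\mathcal{X}\to\mathcal{M}_1(\mathcal{X})$ satisfying $\mathbb{P}_t(x_t)\in\mathcal{R}(x_t,a_t(x_t))$ for all $x_t\in\mathcal{X}$, $t\ge0$. In $\mathbb{E}_{\mathbb{P}}[\,\cdot\,]$ with $\mathbb{P}\in\mathcal{M}_1(\mathcal{X})$,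 $X_1$ has law $\mathbb{P}$. *)

theory Defs
  imports "HOL-Probability.Probability"
begin

definition state_space :: "(real ^ 'd) set \<Rightarrow> (real ^ 'd) measure" where
  "state_space X = restrict_space borel X"

definition prob_measures :: "(real ^ 'd) set \<Rightarrow> (real ^ 'd) measure set" where
  "prob_measures X = space (prob_algebra (state_space X))"

definition bounded_cont :: "(real ^ 'd) set \<Rightarrow> (real ^ 'd \<Rightarrow> real) set" where
  "bounded_cont X = {f. continuous_on X f \<and> bounded (f ` X)}"

text \<open>The coarsest topology on the probability measures on \<open>X\<close> for which integration of every
  bounded continuous function on \<open>X\<close> is continuous.\<close>

definition weak_topology :: "(real ^ 'd) set \<Rightarrow> (real ^ 'd) measure topology" where
  "weak_topology X =
     pullback_topology (prob_measures X) (\<lambda>P. \<lambda>f\<in>bounded_cont X. \<integral>y. f y \<partial>P)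
       (product_topology (\<lambda>_. euclideanreal) (bounded_cont X))"

definition upper_hemicontinuous_map :: "'a topology \<Rightarrow> 'b topology \<Rightarrow> ('a \<Rightarrow> 'b set) \<Rightarrow> bool" where
  "upper_hemicontinuous_map S T F \<longleftrightarrow>
     (\<forall>z\<in>topspace S. \<forall>V. openin T V \<and> F z \<subseteq> V \<longrightarrow>
        (\<exists>U. openin S U \<and> z \<in> U \<and> (\<forall>u\<in>U. F u \<subseteq> V)))"

definition lower_hemicontinuous_map :: "'a topology \<Rightarrow> 'b topology \<Rightarrow> ('a \<Rightarrow> 'b set) \<Rightarrow> bool" where
  "lower_hemicontinuous_map S T F \<longleftrightarrow>
     (\<forall>z\<in>topspace S. \<forall>V. openin T V \<and> F z \<inter> V \<noteq> {} \<longrightarrow>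
        (\<exists>U. openin S U \<and> z \<in> U \<and> (\<forall>u\<in>U. F u \<inter> V \<noteq> {})))"

text \<open>The values of a policy and of the kernels outside \<open>X\<close> are irrelevant. For finite \<open>X\<close> every
  map from \<open>X\<close> to \<open>A\<close> and every map from \<open>X\<close> to the probability measures is measurable, so
  policies carry no measurability condition and the one on the kernels is no restriction.\<close>

definition policies :: "(real ^ 'd) set \<Rightarrow> (real ^ 'm) set \<Rightarrow> (nat \<Rightarrow> real ^ 'd \<Rightarrow> real ^ 'm) set" where
  "policies X A = (UNIV \<rightarrow> (X \<rightarrow> A))"

definition kernels ::
  "(real ^ 'd) set \<Rightarrow> (real ^ 'd \<Rightarrow> real ^ 'm \<Rightarrow> (real ^ 'd) measure set) \<Rightarrow>
   (nat \<Rightarrow> real ^ 'd \<Rightarrow> real ^ 'm) \<Rightarrow> (nat \<Rightarrow> real ^ 'd \<Rightarrow> (real ^ 'd) measure) set" where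
  "kernels X R a =
     {K. \<forall>t. K t \<in> measurable (state_space X) (prob_algebra (state_space X)) \<and>
             (\<forall>y\<in>X. K t y \<in> R y (a t y))}"

text \<open>The law of the process \<open>\<omega> 0, \<omega> 1, \<dots>\<close> that starts in \<open>x\<close> and has the transition kernel
  \<open>K t\<close> from time \<open>t\<close> to time \<open>t + 1\<close>, by the Ionescu-Tulcea construction: the coordinate
  \<open>\<omega> i\<close> has the conditional law \<open>step i \<omega>\<close> given \<open>\<omega> 0, \<dots>, \<omega> (i - 1)\<close>.\<close>

definition path_law ::
  "(real ^ 'd) set \<Rightarrow> real ^ 'd \<Rightarrow> (nat \<Rightarrow> real ^ 'd \<Rightarrow> (real ^ 'd) measure) \<Rightarrow> (nat \<Rightarrow> real ^ 'd) measure" where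
  "path_law X x K =
     (let step = (\<lambda>i \<omega>. case i of 0 \<Rightarrow> return (state_space X) x | Suc t \<Rightarrow> K t (\<omega> t));
          S = (\<lambda>_. state_space X)
      in projective_family.lim UNIV (Ionescu_Tulcea.CI step S) S)"

definition path_laws ::
  "(real ^ 'd) set \<Rightarrow> (real ^ 'd \<Rightarrow> real ^ 'm \<Rightarrow> (real ^ 'd) measure set) \<Rightarrow>
   real ^ 'd \<Rightarrow> (nat \<Rightarrow> real ^ 'd \<Rightarrow> real ^ 'm) \<Rightarrow> (nat \<Rightarrow> real ^ 'd) measure set" where
  "path_laws X R x a = path_law X x ` kernels X R a"

definition robust_value ::
  "(real ^ 'd) set \<Rightarrow> (real ^ 'm) set \<Rightarrow> (real ^ 'd \<Rightarrow> real ^ 'm \<Rightarrow> real ^ 'd \<Rightarrow> real) \<Rightarrow> real \<Rightarrow>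
   (real ^ 'd \<Rightarrow> real ^ 'm \<Rightarrow> (real ^ 'd) measure set) \<Rightarrow> real ^ 'd \<Rightarrow> real" where
  "robust_value X A r \<alpha> R x =
     (SUP a\<in>policies X A. INF P\<in>path_laws X R x a.
        (\<integral>\<omega>. (\<Sum>t. \<alpha> ^ t * r (\<omega> t) (a t (\<omega> t)) (\<omega> (Suc t))) \<partial>P))"

definition robust_Q ::
  "(real ^ 'd) set \<Rightarrow> (real ^ 'm) set \<Rightarrow> (real ^ 'd \<Rightarrow> real ^ 'm \<Rightarrow> real ^ 'd \<Rightarrow> real) \<Rightarrow> real \<Rightarrow>
   (real ^ 'd \<Rightarrow> real ^ 'm \<Rightarrow> (real ^ 'd) measure set) \<Rightarrow> real ^ 'd \<Rightarrow> real ^ 'm \<Rightarrow> real" where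
  "robust_Q X A r \<alpha> R x a =
     (INF P\<in>R x a. (\<integral>y. r x a y + \<alpha> * robust_value X A r \<alpha> R y \<partial>P))"

end

theory Submission
  imports Defs
begin

text \<open>No dynamic programming principle is needed. For two sequences of transition kernels whose rows
  are \<open>\<epsilon>\<close>-close in the \<open>l\<^sup>1\<close> distance, the joint laws of \<open>(X\<^sub>t, X\<^bsub>t+1\<^esub>)\<close> differ by at most
  \<open>(t + 1) \<epsilon>\<close>, so the expected discounted rewards differ by at most \<open>B \<epsilon> / (1 - \<alpha>)\<^sup>2\<close> when
  \<open>\<bar>r\<bar> \<le> B\<close>, uniformly in the policy. Since the probability vectors on the finite set \<open>X\<close> are totally
  bounded, the pointwise approximation of \<open>\<P>(x, a)\<close> by \<open>\<P>\<^sup>(\<^sup>n\<^sup>)(x, a)\<close> is uniform, and every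
  kernel that is feasible for \<open>\<P>\<close> has an \<open>\<epsilon>\<close>-close one that is feasible for \<open>\<P>\<^sup>(\<^sup>n\<^sup>)\<close> once \<open>n\<close> is
  large. Together with \<open>\<P>\<^sup>(\<^sup>n\<^sup>) \<subseteq> \<P>\<close> this squeezes \<open>V\<^sup>(\<^sup>n\<^sup>)\<close> between \<open>V\<close> and \<open>V + O(\<epsilon>)\<close>, and
  \<open>Q\<^sup>(\<^sup>n\<^sup>)\<^sup>*\<close> likewise.\<close>

section \<open>Coordinates of an Ionescu-Tulcea process\<close>

text \<open>The projection to the empty index set has a probability law, and a measure whose image
  is a probability measure is one itself.\<close>

lemma (in Ionescu_Tulcea) prob_space_lim: "prob_space PF.lim"
proof -
  have "prob_space (distr PF.lim (PiM {} M) (\<lambda>\<omega>. restrict \<omega> {}))"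
    unfolding distr_lim[OF finite.emptyI] by (rule PF.prob_space_P) auto
  moreover have "(\<lambda>\<omega>. restrict \<omega> {}) \<in> measurable PF.lim (PiM {} M)"
    by (simp add: measurable_cong_sets[OF PF.sets_lim refl])
  ultimately show ?thesis
    by (rule prob_space_distrD[rotated])
qed

text \<open>The limit measure has the marginal \<open>CI {0..<n}\<close> on the first
  \<open>n\<close> coordinates, and this is the composed kernel \<open>C 0 n\<close>. Integrals over
  paths thereby become integrals over finite compositions of kernels.\<close>

lemma (in Ionescu_Tulcea) nn_integral_lim:
  assumes f: "f \<in> borel_measurable (PiM {0..<n} M)"
  shows "(\<integral>\<^sup>+\<omega>. f (restrict \<omega> {0..<n}) \<partial>PF.lim) = (\<integral>\<^sup>+\<omega>. f \<omega> \<partial>C 0 n (\<lambda>_. undefined))"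
proof -
  \<comment> \<open>\<open>CI J\<close> projects \<open>C 0 (up_to J)\<close> to \<open>J\<close>.
    For an initial segment the horizon is exact and the projection changes nothing.\<close>
  have n: "up_to {0..<n} = n"
    by (rule antisym) (use up_to[of "{0..<n}"] in \<open>auto simp: up_to_iff\<close>)
  have "(\<integral>\<^sup>+\<omega>. f (restrict \<omega> {0..<n}) \<partial>PF.lim)
      = (\<integral>\<^sup>+\<omega>. f \<omega> \<partial>distr PF.lim (PiM {0..<n} M) (\<lambda>\<omega>. restrict \<omega> {0..<n}))"
    using measurable_restrict_subset[of "{0..<n}" UNIV M] f
    by (intro nn_integral_distr[symmetric]) (simp_all add: measurable_cong_sets[OF PF.sets_lim refl] del: restrict_apply)
  also have "distr PF.lim (PiM {0..<n} M) (\<lambda>\<omega>. restrict \<omega> {0..<n}) = CI {0..<n}"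
    by (rule distr_lim) simp
  also have "\<dots> = C 0 n (\<lambda>_. undefined)"
    unfolding CI_def n using distr_C[of n n "\<lambda>_. undefined" 0] by (simp add: space_PiM)
  finally show ?thesis .
qed

text \<open>Since \<open>C 0 (Suc n)\<close> is \<open>C 0 n\<close> followed by the kernel of
  coordinate \<open>n\<close>, the last coordinate can be integrated out first. This is conditioning
  on the past, the source of the Markov property below.\<close>

lemma (in Ionescu_Tulcea) nn_integral_lim_Suc:
  assumes f: "f \<in> borel_measurable (PiM {0..<Suc n} M)"
  shows "(\<integral>\<^sup>+\<omega>. f (restrict \<omega> {0..<Suc n}) \<partial>PF.lim) =
    (\<integral>\<^sup>+\<omega>. (\<integral>\<^sup>+z. f ((restrict \<omega> {0..<n})(n := z)) \<partial>P n (restrict \<omega> {0..<n})) \<partial>PF.lim)"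
    (is "?l = ?r")
proof -
  let ?u = "\<lambda>_::nat. undefined :: 'a"
  have u: "?u \<in> space (PiM {0..<0} M)"
    by (simp add: space_PiM)
  have "?l = (\<integral>\<^sup>+\<omega>. f \<omega> \<partial>C 0 (Suc n) ?u)"
    by (rule nn_integral_lim[OF f])
  also have "\<dots> = (\<integral>\<^sup>+\<omega>. (\<integral>\<^sup>+z. f z \<partial>eP n \<omega>) \<partial>C 0 n ?u)"
    using f by (simp, subst nn_integral_bind[where B="PiM {0..<Suc n} M"])
      (auto simp: measurable_cong_sets[OF sets_C[OF u] refl])
  \<comment> \<open>The inner integral depends on the first \<open>n\<close> coordinates only, so
    \<open>nn_integral_lim\<close> leads back to the limit measure.\<close>
  also have "\<dots> = (\<integral>\<^sup>+\<omega>. (\<integral>\<^sup>+z. f z \<partial>eP n (restrict \<omega> {0..<n})) \<partial>PF.lim)"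
    by (rule nn_integral_lim[symmetric])
      (rule measurable_compose[OF measurable_eP nn_integral_measurable_subprob_algebra[OF f]])
  also have "\<dots> = ?r"
  proof (rule nn_integral_cong)
    fix \<omega> assume "\<omega> \<in> space PF.lim"
    then have "restrict \<omega> {0..<n} \<in> space (PiM {0..<n} M)"
      by (auto simp: space_PiM)
    then show "(\<integral>\<^sup>+z. f z \<partial>eP n (restrict \<omega> {0..<n})) =
        (\<integral>\<^sup>+z. f ((restrict \<omega> {0..<n})(n := z)) \<partial>P n (restrict \<omega> {0..<n}))"
      by (rule nn_integral_eP[OF _ f])
  qed
  finally show ?thesis .
qed

section \<open>Probability measures on a finite state space\<close>

lemma space_state_space [simp]: "space (state_space X) = X"
  by (simp add: state_space_def space_restrict_space)

lemma sets_state_space_finite: "finite X \<Longrightarrow> sets (state_space X) = Pow X"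
  using finite_subset[of _ X]
  by (auto simp: state_space_def sets_restrict_space_iff finite_imp_closed borel_closed)

lemma measurable_state_space_finite:
  "finite X \<Longrightarrow> f \<in> measurable (state_space X) N \<longleftrightarrow> f \<in> X \<rightarrow> space N"
  by (auto simp: measurable_def sets_state_space_finite)

lemma prob_measuresD:
  assumes "p \<in> prob_measures X"
  shows "prob_space p" "sets p = sets (state_space X)" "space p = X"
  using assms unfolding prob_measures_def space_prob_algebra
  by (auto dest: sets_eq_imp_space_eq)

lemma integral_finite_state:
  fixes f :: "real ^ 'd \<Rightarrow> real"
  assumes "finite X" "p \<in> prob_measures X"
  shows "(\<integral>y. f y \<partial>p) = (\<Sum>z\<in>X. f z * measure p {z})"
proof -
  interpret prob_space p using prob_measuresD[OF assms(2)] by simp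
  have sets: "sets p = Pow X" and space: "space p = X"
    using prob_measuresD[OF assms(2)] sets_state_space_finite[OF assms(1)] by auto
  have "(\<integral>y. f y \<partial>p) = (\<integral>y. (\<Sum>z\<in>X. f z * indicator {z} y) \<partial>p)"
    by (rule Bochner_Integration.integral_cong)
      (auto simp: space indicator_def assms(1) if_distrib[of "(*) _"] sum.delta cong: if_cong)
  also have "\<dots> = (\<Sum>z\<in>X. f z * measure p {z})"
    by (subst Bochner_Integration.integral_sum)
      (auto simp: sets space Int_absorb2 simp flip: less_top)
  finally show ?thesis .
qed

lemma sum_measure_finite_state:
  assumes "finite X" "p \<in> prob_measures X"
  shows "(\<Sum>z\<in>X. measure p {z}) = 1"
proof -
  interpret prob_space p using prob_measuresD[OF assms(2)] by simp
  show ?thesis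
    using integral_finite_state[OF assms, of "\<lambda>_. 1"] prob_space by simp
qed

text \<open>Integration of \<open>f\<close> is the pullback map followed by the projection to
  coordinate \<open>f\<close>, hence continuous for the weak topology.\<close>

lemma limitin_weak_topologyD:
  assumes "limitin (weak_topology X) q p F" "f \<in> bounded_cont X"
  shows "((\<lambda>n. \<integral>y. f y \<partial>q n) \<longlongrightarrow> (\<integral>y. f y \<partial>p)) F"
proof -
  have "continuous_map (weak_topology X) euclideanreal
      ((\<lambda>g. g f) \<circ> (\<lambda>P. \<lambda>f\<in>bounded_cont X. \<integral>y. f y \<partial>P))"
    unfolding weak_topology_def
    by (intro continuous_map_pullback continuous_map_product_projection assms(2))
  from continuous_map_limit[OF this assms(1)] show ?thesis
    using assms(2) by (simp add: comp_def)
qed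

text \<open>Every function on a finite set is continuous and bounded, so the indicator of a point is
  an admissible test function.\<close>

lemma limitin_weak_topology_singleton:
  assumes "limitin (weak_topology X) q p F" "finite X" "z \<in> X"
    and "\<And>n. q n \<in> prob_measures X" "p \<in> prob_measures X"
  shows "((\<lambda>n. measure (q n) {z}) \<longlongrightarrow> measure p {z}) F"
proof -
  let ?f = "indicator {z} :: _ \<Rightarrow> real"
  have "?f \<in> bounded_cont X"
    using assms(2) by (simp add: bounded_cont_def continuous_on_finite finite_imp_bounded)
  moreover have "(\<integral>y. ?f y \<partial>p') = measure p' {z}" if "p' \<in> prob_measures X" for p'
    using prob_measuresD[OF that] assms(3) by (simp add: Int_absorb2)
  ultimately show ?thesis
    using limitin_weak_topologyD[OF assms(1), of ?f] assms(4,5) by simp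
qed

section \<open>Markov chains on a finite state space\<close>

locale finite_chain =
  fixes X :: "(real ^ 'd) set" and x :: "real ^ 'd" and K :: "nat \<Rightarrow> real ^ 'd \<Rightarrow> (real ^ 'd) measure"
  assumes finite_X: "finite X" and x_in: "x \<in> X" and K_in: "\<And>t y. y \<in> X \<Longrightarrow> K t y \<in> prob_measures X"
begin

text \<open>A named copy of the function bound by \<open>let\<close> in \<open>path_law\<close>,
  with which the Ionescu-Tulcea locale is instantiated.\<close>

definition step :: "nat \<Rightarrow> (nat \<Rightarrow> real ^ 'd) \<Rightarrow> (real ^ 'd) measure" where
  "step i \<omega> = (case i of 0 \<Rightarrow> return (state_space X) x | Suc t \<Rightarrow> K t (\<omega> t))"

lemma kernel_measurable: "K t \<in> measurable (state_space X) (prob_algebra (state_space X))"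
  using K_in finite_X by (simp add: measurable_state_space_finite prob_measures_def)

lemma step_measurable: "step i \<in> measurable (PiM {0..<i} (\<lambda>_. state_space X)) (prob_algebra (state_space X))"
proof (cases i)
  case 0
  have "return (state_space X) x \<in> space (prob_algebra (state_space X))"
    using x_in by (auto simp: space_prob_algebra intro: prob_space_return)
  then show ?thesis
    unfolding step_def[abs_def] 0 by simp
next
  case (Suc t)
  have "(\<lambda>\<omega>. \<omega> t) \<in> measurable (PiM {0..<i} (\<lambda>_. state_space X)) (state_space X)"
    unfolding Suc by (rule measurable_component_singleton) simp
  from measurable_compose[OF this kernel_measurable] show ?thesis
    unfolding step_def[abs_def] Suc by simp
qed

lemma prob_space_step:
  "\<omega> \<in> space (PiM {0..<i} (\<lambda>_. state_space X)) \<Longrightarrow> prob_space (step i \<omega>)"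
  using measurable_space[OF step_measurable] by (simp add: space_prob_algebra)

sublocale IT: Ionescu_Tulcea step "\<lambda>_. state_space X"
  by (rule Ionescu_Tulcea.intro, rule measurable_prob_algebraD[OF step_measurable], rule prob_space_step)

abbreviation law :: "(nat \<Rightarrow> real ^ 'd) measure" where
  "law \<equiv> path_law X x K"

lemma law_eq: "law = IT.PF.lim"
  unfolding path_law_def Let_def step_def[abs_def] ..

lemma prob_space_law: "prob_space law"
  unfolding law_eq by (rule IT.prob_space_lim)

lemma space_law: "space law = (UNIV \<rightarrow> X)"
  by (auto simp: law_eq space_PiM)

lemma coordinate_measurable: "(\<lambda>\<omega>. \<omega> t) \<in> measurable law (state_space X)"
  unfolding law_eq measurable_cong_sets[OF IT.PF.sets_lim refl]
  by (rule measurable_component_singleton) simp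

text \<open>The product of two finite discrete sigma-algebras is discrete, so a reward depending on
  two coordinates is measurable whatever its form.\<close>

lemma sets_state_pair: "sets (state_space X \<Otimes>\<^sub>M state_space X) = sets (count_space (X \<times> X))"
proof -
  have "sets (state_space X \<Otimes>\<^sub>M state_space X) = sets (count_space X \<Otimes>\<^sub>M count_space X)"
    using finite_X by (intro sets_pair_measure_cong) (simp_all add: sets_state_space_finite)
  then show ?thesis
    by (simp only: pair_measure_count_space[OF finite_X finite_X])
qed

lemma coordinates_measurable:
  "(\<lambda>\<omega>. g (\<omega> s) (\<omega> t)) \<in> borel_measurable law" for g :: "_ \<Rightarrow> _ \<Rightarrow> real"
proof -
  have "(\<lambda>\<omega>. (\<omega> s, \<omega> t)) \<in> measurable law (state_space X \<Otimes>\<^sub>M state_space X)"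
    by (intro measurable_Pair coordinate_measurable)
  moreover have "case_prod g \<in> borel_measurable (state_space X \<Otimes>\<^sub>M state_space X)"
    unfolding measurable_cong_sets[OF sets_state_pair refl] by simp
  ultimately show ?thesis by simp
qed

section \<open>Marginals and one-step transitions of the chain\<close>

definition marginal :: "nat \<Rightarrow> real ^ 'd \<Rightarrow> real" where
  "marginal t y = measure law {\<omega> \<in> space law. \<omega> t = y}"

lemma singleton_in_law:
  "y \<in> X \<Longrightarrow> {\<omega> \<in> space law. \<omega> t = y} \<in> sets law"
  using measurable_sets[OF coordinate_measurable, of "{y}" t] finite_X
  by (simp add: sets_state_space_finite vimage_def Int_def conj_commute)

lemma emeasure_initial:
  assumes "y \<in> X"
  shows "emeasure law {\<omega> \<in> space law. \<omega> 0 = y} = indicator {x} y"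
proof -
  let ?f = "\<lambda>\<omega>. indicator {y} (\<omega> 0) :: ennreal"
  have y: "{y} \<in> sets (state_space X)"
    using assms finite_X by (auto simp: sets_state_space_finite)
  then have f: "?f \<in> borel_measurable (PiM {0..<Suc 0} (\<lambda>_. state_space X))"
    by measurable
  have "emeasure law {\<omega> \<in> space law. \<omega> 0 = y} =
     (\<integral>\<^sup>+\<omega>. indicator {\<omega> \<in> space law. \<omega> 0 = y} \<omega> \<partial>law)"
    using singleton_in_law[OF assms] by simp
  also have "\<dots> = (\<integral>\<^sup>+\<omega>. ?f (restrict \<omega> {0..<Suc 0}) \<partial>law)"
    by (rule nn_integral_cong) (auto simp: indicator_def)
  \<comment> \<open>With no past to condition on, the inner integral is against
    \<open>step 0\<close>, the point mass in \<open>x\<close>.\<close>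
  also have "\<dots> = (\<integral>\<^sup>+\<omega>. (\<integral>\<^sup>+z. indicator {y} z \<partial>return (state_space X) x) \<partial>law)"
    unfolding law_eq
    by (subst IT.nn_integral_lim_Suc[OF f]) (simp add: step_def)
  also have "\<dots> = indicator {x} y"
    using prob_space.emeasure_space_1[OF prob_space_law]
    by (subst nn_integral_indicator) (auto simp: y indicator_def)
  finally show ?thesis .
qed

text \<open>The Markov property: conditioning on the coordinates up to time \<open>t\<close> leaves
  an integral against \<open>K t (\<omega> t)\<close>, and the indicator of
  \<open>\<omega> t = y\<close> allows \<open>K t y\<close> to be put in its place.\<close>

lemma emeasure_transition:
  assumes "y \<in> X" "z \<in> X"
  shows "emeasure law {\<omega> \<in> space law. \<omega> t = y \<and> \<omega> (Suc t) = z} =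
    emeasure law {\<omega> \<in> space law. \<omega> t = y} * emeasure (K t y) {z}"
proof -
  let ?f = "\<lambda>\<omega>. indicator {y} (\<omega> t) * indicator {z} (\<omega> (Suc t)) :: ennreal"
  have [measurable]: "{y} \<in> sets (state_space X)" "{z} \<in> sets (state_space X)"
    using assms finite_X by (auto simp: sets_state_space_finite)
  have f: "?f \<in> borel_measurable (PiM {0..<Suc (Suc t)} (\<lambda>_. state_space X))"
    by measurable
  have "emeasure law {\<omega> \<in> space law. \<omega> t = y \<and> \<omega> (Suc t) = z} = 
     (\<integral>\<^sup>+\<omega>. indicator {\<omega> \<in> space law. \<omega> t = y \<and> \<omega> (Suc t) = z} \<omega> \<partial>law)"
    using sets.sets_Collect_conj[OF singleton_in_law[OF assms(2), of "Suc t"] singleton_in_law[OF assms(1), of t]]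
    by simp
  also have "\<dots> = (\<integral>\<^sup>+\<omega>. ?f (restrict \<omega> {0..<Suc (Suc t)}) \<partial>law)"
    by (rule nn_integral_cong) (auto simp: indicator_def)
  also have "\<dots> = (\<integral>\<^sup>+\<omega>. (\<integral>\<^sup>+z'. indicator {y} (\<omega> t) * indicator {z} z' \<partial>K t (\<omega> t)) \<partial>law)"
    unfolding law_eq
    by (subst IT.nn_integral_lim_Suc[OF f]) (simp add: step_def)
  also have "\<dots> = (\<integral>\<^sup>+\<omega>. emeasure (K t y) {z} * indicator {\<omega> \<in> space law. \<omega> t = y} \<omega> \<partial>law)"
  proof (rule nn_integral_cong)
    fix \<omega> assume "\<omega> \<in> space law"
    then have "{z} \<in> sets (K t (\<omega> t))"
      using assms prob_measuresD[OF K_in, of "\<omega> t" t] finite_X by (auto simp: space_law sets_state_space_finite)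
    then show "(\<integral>\<^sup>+z'. indicator {y} (\<omega> t) * indicator {z} z' \<partial>K t (\<omega> t))
        = emeasure (K t y) {z} * indicator {\<omega> \<in> space law. \<omega> t = y} \<omega>"
      using \<open>\<omega> \<in> space law\<close> by (cases "\<omega> t = y") simp_all
  qed
  also have "\<dots> = emeasure law {\<omega> \<in> space law. \<omega> t = y} * emeasure (K t y) {z}"
    using singleton_in_law[OF assms(1)] by (simp add: nn_integral_cmult_indicator mult.commute)
  finally show ?thesis .
qed

lemma marginal_0: "y \<in> X \<Longrightarrow> marginal 0 y = indicator {x} y"
  by (simp add: marginal_def measure_def emeasure_initial indicator_def)

lemma marginal_nonneg: "0 \<le> marginal t y"
  by (simp add: marginal_def)

lemma measure_transition:
  "y \<in> X \<Longrightarrow> z \<in> X \<Longrightarrow>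
    measure law {\<omega> \<in> space law. \<omega> t = y \<and> \<omega> (Suc t) = z} = marginal t y * measure (K t y) {z}"
  by (simp add: marginal_def measure_def emeasure_transition enn2real_mult)

text \<open>A function of two consecutive coordinates is a finite combination of indicators of pair
  events. From here on, expectations at one time are finite sums and path space is left
  behind.\<close>

lemma expectation_transition:
  fixes g :: "real ^ 'd \<Rightarrow> real ^ 'd \<Rightarrow> real"
  shows "(\<integral>\<omega>. g (\<omega> t) (\<omega> (Suc t)) \<partial>law) =
    (\<Sum>y\<in>X. \<Sum>z\<in>X. g y z * (marginal t y * measure (K t y) {z}))"
proof -
  interpret law: prob_space law by (rule prob_space_law)
  let ?S = "\<lambda>y z. {\<omega> \<in> space law. \<omega> t = y \<and> \<omega> (Suc t) = z}"
  have S: "?S y z \<in> sets law" if "y \<in> X" "z \<in> X" for y z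
    using sets.sets_Collect_conj[OF singleton_in_law[OF that(2), of "Suc t"] singleton_in_law[OF that(1), of t]]
    by simp
  have "(\<integral>\<omega>. g (\<omega> t) (\<omega> (Suc t)) \<partial>law) =
      (\<integral>\<omega>. (\<Sum>y\<in>X. \<Sum>z\<in>X. g y z * indicator (?S y z) \<omega>) \<partial>law)"
  proof (rule Bochner_Integration.integral_cong[OF refl])
    fix \<omega> assume \<omega>: "\<omega> \<in> space law"
    have "(\<Sum>y\<in>X. \<Sum>z\<in>X. g y z * indicator (?S y z) \<omega>)
        = (\<Sum>y\<in>X. if y = \<omega> t then (\<Sum>z\<in>X. if z = \<omega> (Suc t) then g y z else 0) else 0)"
      using \<omega> by (intro sum.cong refl) (auto simp: indicator_def intro!: sum.cong)
    also have "\<dots> = g (\<omega> t) (\<omega> (Suc t))"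
      using \<omega> finite_X by (auto simp: space_law sum.delta)
    finally show "g (\<omega> t) (\<omega> (Suc t)) = (\<Sum>y\<in>X. \<Sum>z\<in>X. g y z * indicator (?S y z) \<omega>)" ..
  qed
  also have "\<dots> = (\<Sum>y\<in>X. \<Sum>z\<in>X. g y z * measure law (?S y z))"
    using S by (simp add: Bochner_Integration.integral_sum Bochner_Integration.integrable_sum less_top[symmetric])
  finally show ?thesis
    by (simp add: measure_transition)
qed

text \<open>The Chapman-Kolmogorov recursion, read off from \<open>expectation_transition\<close>
  for the indicator of the second coordinate.\<close>

lemma marginal_Suc:
  assumes "z \<in> X"
  shows "marginal (Suc t) z = (\<Sum>y\<in>X. marginal t y * measure (K t y) {z})"
proof -
  have "marginal (Suc t) z = (\<integral>\<omega>. indicator {\<omega> \<in> space law. \<omega> (Suc t) = z} \<omega> \<partial>law)"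
    using singleton_in_law[OF assms, of "Suc t"] by (simp add: marginal_def Int_absorb2)
  also have "\<dots> = (\<integral>\<omega>. indicator {z} (\<omega> (Suc t)) \<partial>law)"
    by (rule Bochner_Integration.integral_cong) (auto simp: indicator_def)
  also have "\<dots> = (\<Sum>y\<in>X. \<Sum>z'\<in>X. indicator {z} z' * (marginal t y * measure (K t y) {z'}))"
    by (rule expectation_transition)
  also have "\<dots> = (\<Sum>y\<in>X. marginal t y * measure (K t y) {z})"
    using assms finite_X by (simp add: indicator_def sum.delta)
  finally show ?thesis .
qed

lemma sum_marginal: "(\<Sum>y\<in>X. marginal t y) = 1"
proof -
  interpret law: prob_space law by (rule prob_space_law)
  have "(1 :: real) = (\<integral>\<omega>. 1 \<partial>law)"
    by (simp add: law.prob_space)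
  also have "\<dots> = (\<Sum>y\<in>X. \<Sum>z\<in>X. marginal t y * measure (K t y) {z})"
    using expectation_transition[of "\<lambda>_ _. 1" t] by simp
  also have "\<dots> = (\<Sum>y\<in>X. marginal t y)"
    using sum_measure_finite_state[OF finite_X K_in] by (simp flip: sum_distrib_left)
  finally show ?thesis ..
qed

text \<open>The summable majorant \<open>b\<close> bounds the expected absolute values as well as
  the pathwise terms, which permits exchanging series and expectation.\<close>

lemma expectation_total:
  fixes g :: "nat \<Rightarrow> real ^ 'd \<Rightarrow> real ^ 'd \<Rightarrow> real"
  assumes "summable b" "\<And>t y z. y \<in> X \<Longrightarrow> z \<in> X \<Longrightarrow> \<bar>g t y z\<bar> \<le> b t"
  shows "(\<lambda>t. \<integral>\<omega>. g t (\<omega> t) (\<omega> (Suc t)) \<partial>law) sums (\<integral>\<omega>. (\<Sum>t. g t (\<omega> t) (\<omega> (Suc t))) \<partial>law)"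
    and "\<bar>\<integral>\<omega>. g t (\<omega> t) (\<omega> (Suc t)) \<partial>law\<bar> \<le> b t"
proof -
  interpret law: prob_space law by (rule prob_space_law)
  have bound: "\<bar>g t (\<omega> t) (\<omega> (Suc t))\<bar> \<le> b t" if "\<omega> \<in> space law" for \<omega> t
    using that by (intro assms) (auto simp: space_law)
  have int: "integrable law (\<lambda>\<omega>. g t (\<omega> t) (\<omega> (Suc t)))" for t
    using bound by (intro law.integrable_const_bound[of _ "b t"] AE_I2 coordinates_measurable) simp_all
  have le: "(\<integral>\<omega>. norm (g t (\<omega> t) (\<omega> (Suc t))) \<partial>law) \<le> b t" for t
    using int[of t] bound by (intro law.integral_le_const) (auto intro!: AE_I2)
  show "\<bar>\<integral>\<omega>. g t (\<omega> t) (\<omega> (Suc t)) \<partial>law\<bar> \<le> b t"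
    unfolding real_norm_def[symmetric] by (rule order.trans[OF integral_norm_bound le])
  show "(\<lambda>t. \<integral>\<omega>. g t (\<omega> t) (\<omega> (Suc t)) \<partial>law) sums (\<integral>\<omega>. (\<Sum>t. g t (\<omega> t) (\<omega> (Suc t))) \<partial>law)"
  proof (rule sums_integral[OF int])
    show "AE \<omega> in law. summable (\<lambda>t. norm (g t (\<omega> t) (\<omega> (Suc t))))"
      using bound by (intro AE_I2 summable_comparison_test'[OF assms(1)]) auto
    show "summable (\<lambda>t. \<integral>\<omega>. norm (g t (\<omega> t) (\<omega> (Suc t))) \<partial>law)"
      using le by (intro summable_comparison_test'[OF assms(1)]) auto
  qed
qed

end

section \<open>Perturbation of the kernels\<close>

text \<open>Let \<open>?d t\<close> and \<open>?D t\<close> be the \<open>l1\<close> distances of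
  the marginals at time \<open>t\<close> and of the joint laws at times \<open>t\<close>,
  \<open>t + 1\<close>. One transition adds at most \<open>\<epsilon>\<close>, so
  \<open>?D t \<le> ?d t + \<epsilon>\<close>; summing out a coordinate gives
  \<open>?d (Suc t) \<le> ?D t\<close>; and \<open>?d 0 = 0\<close> because both chains start in
  \<open>x\<close>.\<close>

lemma transition_perturbation:
  fixes X :: "(real ^ 'd) set"
  assumes "finite_chain X x K" "finite_chain X x L"
    and close: "\<And>t y. y \<in> X \<Longrightarrow> (\<Sum>z\<in>X. \<bar>measure (K t y) {z} - measure (L t y) {z}\<bar>) \<le> \<epsilon>"
  shows "(\<Sum>y\<in>X. \<Sum>z\<in>X. \<bar>finite_chain.marginal X x K t y * measure (K t y) {z} -
      finite_chain.marginal X x L t y * measure (L t y) {z}\<bar>) \<le> real (Suc t) * \<epsilon>"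
proof -
  interpret K: finite_chain X x K by fact
  interpret L: finite_chain X x L by fact
  let ?k = "\<lambda>t y z. measure (K t y) {z}" and ?l = "\<lambda>t y z. measure (L t y) {z}"
  let ?d = "\<lambda>t. \<Sum>y\<in>X. \<bar>K.marginal t y - L.marginal t y\<bar>"
  let ?D = "\<lambda>t. \<Sum>y\<in>X. \<Sum>z\<in>X. \<bar>K.marginal t y * ?k t y z - L.marginal t y * ?l t y z\<bar>"
  have D: "?D t \<le> ?d t + \<epsilon>" for t
  proof -
    have "?D t \<le> (\<Sum>y\<in>X. \<Sum>z\<in>X. \<bar>K.marginal t y - L.marginal t y\<bar> * ?k t y z
        + L.marginal t y * \<bar>?k t y z - ?l t y z\<bar>)"
    proof (intro sum_mono)
      fix y z
      \<comment> \<open>In this splitting the weights \<open>?k t y z\<close> and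
        \<open>L.marginal t y\<close> sum to 1 over \<open>z\<close> and over \<open>y\<close>, so
        no factor \<open>card X\<close> arises.\<close>
      have "K.marginal t y * ?k t y z - L.marginal t y * ?l t y z =
          (K.marginal t y - L.marginal t y) * ?k t y z + L.marginal t y * (?k t y z - ?l t y z)"
        by (simp add: algebra_simps)
      then show "\<bar>K.marginal t y * ?k t y z - L.marginal t y * ?l t y z\<bar> \<le>
          \<bar>K.marginal t y - L.marginal t y\<bar> * ?k t y z + L.marginal t y * \<bar>?k t y z - ?l t y z\<bar>"
        using abs_triangle_ineq[of "(K.marginal t y - L.marginal t y) * ?k t y z"
            "L.marginal t y * (?k t y z - ?l t y z)"] L.marginal_nonneg[of t y]
        by (simp add: abs_mult)
    qed
    also have "\<dots> = ?d t + (\<Sum>y\<in>X. L.marginal t y * (\<Sum>z\<in>X. \<bar>?k t y z - ?l t y z\<bar>))"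
      using sum_measure_finite_state[OF K.finite_X K.K_in]
      by (simp add: sum.distrib flip: sum_distrib_left)
    also have "\<dots> \<le> ?d t + (\<Sum>y\<in>X. L.marginal t y * \<epsilon>)"
      by (intro add_left_mono sum_mono mult_left_mono close L.marginal_nonneg)
    also have "\<dots> = ?d t + \<epsilon>"
      by (simp add: L.sum_marginal flip: sum_distrib_right)
    finally show ?thesis .
  qed
  have "?d t \<le> real t * \<epsilon>" for t
  proof (induction t)
    case 0
    then show ?case by (simp add: K.marginal_0 L.marginal_0)
  next
    case (Suc t)
    \<comment> \<open>By \<open>marginal_Suc\<close> the masses at time \<open>Suc t\<close> are
      column sums of the joint masses, and the absolute value moves inside the sum.\<close>
    have "?d (Suc t) \<le> (\<Sum>z\<in>X. \<Sum>y\<in>X. \<bar>K.marginal t y * ?k t y z - L.marginal t y * ?l t y z\<bar>)"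
      by (intro sum_mono) (simp add: K.marginal_Suc L.marginal_Suc sum_abs flip: sum_subtractf)
    also have "\<dots> = ?D t"
      by (rule sum.swap)
    also have "\<dots> \<le> real (Suc t) * \<epsilon>"
      using D[of t] Suc by (simp add: algebra_simps)
    finally show ?case .
  qed
  from this[of t] D[of t] show ?thesis
    by (simp add: algebra_simps)
qed

text \<open>A geometric series dominates the terms. The integrand \<open>g\<close> depends on
  \<open>t\<close> so that it can absorb both the discount factor and a policy that changes with
  time.\<close>

lemma discounted_bound:
  fixes g :: "nat \<Rightarrow> real ^ 'd \<Rightarrow> real ^ 'd \<Rightarrow> real"
  assumes "finite_chain X x K" and \<alpha>: "0 < \<alpha>" "\<alpha> < 1"
    and g: "\<And>t y z. y \<in> X \<Longrightarrow> z \<in> X \<Longrightarrow> \<bar>g t y z\<bar> \<le> \<alpha> ^ t * B"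
  shows "\<bar>\<integral>\<omega>. (\<Sum>t. g t (\<omega> t) (\<omega> (Suc t))) \<partial>path_law X x K\<bar> \<le> B / (1 - \<alpha>)"
proof -
  interpret K: finite_chain X x K by fact
  have sums: "(\<lambda>t. \<alpha> ^ t * B) sums (B / (1 - \<alpha>))"
    using sums_mult2[OF geometric_sums[of \<alpha>], of B] \<alpha> by (simp add: field_simps)
  have E: "(\<lambda>t. \<integral>\<omega>. g t (\<omega> t) (\<omega> (Suc t)) \<partial>K.law) sums (\<integral>\<omega>. (\<Sum>t. g t (\<omega> t) (\<omega> (Suc t))) \<partial>K.law)"
    by (rule K.expectation_total(1)[OF sums_summable[OF sums]]) (rule g)
  have "\<bar>\<Sum>t. \<integral>\<omega>. g t (\<omega> t) (\<omega> (Suc t)) \<partial>K.law\<bar> \<le> (\<Sum>t. \<alpha> ^ t * B)"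
    unfolding real_norm_def[symmetric]
    by (rule norm_suminf_le[OF _ sums_summable[OF sums]], unfold real_norm_def,
        rule K.expectation_total(2)[OF sums_summable[OF sums]]) (rule g)
  then show ?thesis
    by (simp add: sums_unique[OF E] sums_unique[OF sums])
qed

text \<open>At time \<open>t\<close> the expectations differ by at most
  \<open>\<alpha> ^ t * B\<close> times the distance \<open>(t + 1) * \<epsilon>\<close> of the
  joint laws, and these errors are summable.\<close>

lemma discounted_perturbation:
  fixes g :: "nat \<Rightarrow> real ^ 'd \<Rightarrow> real ^ 'd \<Rightarrow> real"
  assumes "finite_chain X x K" "finite_chain X x L" and \<alpha>: "0 < \<alpha>" "\<alpha> < 1" and "0 \<le> B"
    and g: "\<And>t y z. y \<in> X \<Longrightarrow> z \<in> X \<Longrightarrow> \<bar>g t y z\<bar> \<le> \<alpha> ^ t * B"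
    and close: "\<And>t y. y \<in> X \<Longrightarrow> (\<Sum>z\<in>X. \<bar>measure (K t y) {z} - measure (L t y) {z}\<bar>) \<le> \<epsilon>"
  shows "\<bar>(\<integral>\<omega>. (\<Sum>t. g t (\<omega> t) (\<omega> (Suc t))) \<partial>path_law X x K) -
    (\<integral>\<omega>. (\<Sum>t. g t (\<omega> t) (\<omega> (Suc t))) \<partial>path_law X x L)\<bar> \<le> B * \<epsilon> / (1 - \<alpha>)\<^sup>2"
proof -
  interpret K: finite_chain X x K by fact
  interpret L: finite_chain X x L by fact
  have summable: "summable (\<lambda>t. \<alpha> ^ t * B)"
    using \<alpha> by (intro summable_mult2 summable_geometric) simp
  let ?K = "\<lambda>t. \<integral>\<omega>. g t (\<omega> t) (\<omega> (Suc t)) \<partial>K.law"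
  let ?L = "\<lambda>t. \<integral>\<omega>. g t (\<omega> t) (\<omega> (Suc t)) \<partial>L.law"
  \<comment> \<open>The differentiated geometric series produces the square in the
    denominator.\<close>
  have sums: "(\<lambda>t. real (Suc t) * \<alpha> ^ t * (B * \<epsilon>)) sums (B * \<epsilon> / (1 - \<alpha>)\<^sup>2)"
    using sums_mult2[OF geometric_deriv_sums[of \<alpha>], of "B * \<epsilon>"] \<alpha> by simp
  have diff: "(\<lambda>t. ?K t - ?L t) sums
      ((\<integral>\<omega>. (\<Sum>t. g t (\<omega> t) (\<omega> (Suc t))) \<partial>K.law) - (\<integral>\<omega>. (\<Sum>t. g t (\<omega> t) (\<omega> (Suc t))) \<partial>L.law))"
    by (intro sums_diff K.expectation_total(1)[OF summable g] L.expectation_total(1)[OF summable g])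
  have "\<bar>?K t - ?L t\<bar> \<le> real (Suc t) * \<alpha> ^ t * (B * \<epsilon>)" for t
  proof -
    let ?d = "\<lambda>y z. K.marginal t y * measure (K t y) {z} - L.marginal t y * measure (L t y) {z}"
    have "\<bar>?K t - ?L t\<bar> = \<bar>\<Sum>y\<in>X. \<Sum>z\<in>X. g t y z * ?d y z\<bar>"
      unfolding K.expectation_transition[of "g t"] L.expectation_transition[of "g t"]
      by (simp add: sum_subtractf right_diff_distrib)
    also have "\<dots> \<le> (\<Sum>y\<in>X. \<Sum>z\<in>X. \<bar>g t y z * ?d y z\<bar>)"
      by (intro order.trans[OF sum_abs] sum_mono sum_abs)
    also have "\<dots> \<le> (\<Sum>y\<in>X. \<Sum>z\<in>X. \<alpha> ^ t * B * \<bar>?d y z\<bar>)"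
      unfolding abs_mult by (intro sum_mono mult_right_mono g) auto
    also have "\<dots> = \<alpha> ^ t * B * (\<Sum>y\<in>X. \<Sum>z\<in>X. \<bar>?d y z\<bar>)"
      by (simp add: sum_distrib_left)
    also have "\<dots> \<le> \<alpha> ^ t * B * (real (Suc t) * \<epsilon>)"
      using \<alpha> \<open>0 \<le> B\<close>
      by (intro mult_left_mono transition_perturbation[OF assms(1,2) close]) simp_all
    finally show ?thesis
      by (simp only: mult_ac)
  qed
  then have "\<bar>\<Sum>t. ?K t - ?L t\<bar> \<le> (\<Sum>t. real (Suc t) * \<alpha> ^ t * (B * \<epsilon>))"
    unfolding real_norm_def[symmetric] by (rule norm_suminf_le[OF _ sums_summable[OF sums]])
  then show ?thesis
    by (simp add: sums_unique[OF diff] sums_unique[OF sums])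
qed

section \<open>Uniform approximation\<close>

text \<open>Measures whose point masses agree after rounding down to multiples of \<open>1 / m\<close> are
  \<open>card X / m\<close>-close in total variation, and rounding leaves only finitely many classes.\<close>

lemma prob_measures_totally_bounded:
  fixes X :: "(real ^ 'd) set"
  assumes X: "finite X" and S: "S \<subseteq> prob_measures X" and "0 < \<epsilon>"
  obtains T where "finite T" "T \<subseteq> S"
    "\<And>p. p \<in> S \<Longrightarrow> \<exists>q\<in>T. (\<Sum>z\<in>X. \<bar>measure q {z} - measure p {z}\<bar>) \<le> \<epsilon>"
proof -
  obtain m :: nat where m: "card X / \<epsilon> < real m"
    using reals_Archimedean2 by blast
  have "0 \<le> card X / \<epsilon>"
    using \<open>0 < \<epsilon>\<close> by simp
  then have "0 < m"
    using m by linarith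
  define grid where "grid p = (\<lambda>z\<in>X. \<lfloor>real m * measure p {z}\<rfloor>)" for p :: "(real ^ 'd) measure"
  have "grid ` S \<subseteq> PiE X (\<lambda>_. {0..int m})"
  proof (rule image_subsetI)
    fix p assume "p \<in> S"
    then interpret prob_space p
      using S prob_measuresD(1) by blast
    \<comment> \<open>The strict bound by \<open>m + 1\<close> is what \<open>floor_le_iff\<close>
      asks for to place the floor in \<open>{0..int m}\<close>.\<close>
    have "real m * measure p {z} < real m + 1" for z
      by (rule le_less_trans[OF mult_left_le]) auto
    then show "grid p \<in> PiE X (\<lambda>_. {0..int m})"
      by (auto simp: grid_def floor_le_iff)
  qed
  moreover have "finite (PiE X (\<lambda>_. {0..int m}))"
    using X by (intro finite_PiE) auto
  ultimately have "finite (grid ` S)"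
    by (rule finite_subset)
  \<comment> \<open>\<open>T\<close> holds representatives of all occupied grid classes, taken from
    \<open>S\<close> itself.\<close>
  then obtain T where T: "T \<subseteq> S" "finite T" "grid ` S = grid ` T"
    by (meson finite_subset_image order_refl)
  show thesis
  proof (rule that[OF T(2,1)])
    fix p assume "p \<in> S"
    then have "grid p \<in> grid ` T"
      using T(3) by blast
    then obtain q where q: "q \<in> T" "grid q = grid p"
      by auto
    have "\<bar>measure q {z} - measure p {z}\<bar> \<le> 1 / m" if "z \<in> X" for z
    proof -
      have "\<lfloor>real m * measure q {z}\<rfloor> = \<lfloor>real m * measure p {z}\<rfloor>"
        using fun_cong[OF q(2), of z] that by (simp add: grid_def)
      then have "\<bar>real m * measure q {z} - real m * measure p {z}\<bar> \<le> 1"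
        by linarith
      then have "real m * \<bar>measure q {z} - measure p {z}\<bar> \<le> 1"
        by (simp add: abs_mult flip: right_diff_distrib)
      then show ?thesis
        using \<open>0 < m\<close> by (simp add: field_simps)
    qed
    then have "(\<Sum>z\<in>X. \<bar>measure q {z} - measure p {z}\<bar>) \<le> card X * (1 / m)"
      by (rule sum_bounded_above)
    also have "\<dots> \<le> \<epsilon>"
      using m \<open>0 < \<epsilon>\<close> \<open>0 < m\<close> by (simp add: field_simps)
    finally show "\<exists>q\<in>T. (\<Sum>z\<in>X. \<bar>measure q {z} - measure p {z}\<bar>) \<le> \<epsilon>"
      using q(1) by blast
  qed
qed

text \<open>Take a finite \<open>\<epsilon> / 2\<close>-net \<open>T\<close> inside
  \<open>S\<close>. Each of its finitely many points is eventually approximated within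
  \<open>\<epsilon> / 2\<close>, and the triangle inequality through the net point carries this over
  to all of \<open>S\<close> at once.\<close>

lemma uniform_approximation:
  fixes X :: "(real ^ 'd) set"
  assumes X: "finite X" and S: "S \<subseteq> prob_measures X" and Q: "\<And>n. Q n \<subseteq> prob_measures X"
    and lim: "\<And>p. p \<in> S \<Longrightarrow> \<exists>q. (\<forall>n. q n \<in> Q n) \<and> limitin (weak_topology X) q p sequentially"
    and "0 < \<epsilon>"
  shows "\<forall>\<^sub>F n in sequentially. \<forall>p\<in>S. \<exists>q\<in>Q n. (\<Sum>z\<in>X. \<bar>measure p {z} - measure q {z}\<bar>) \<le> \<epsilon>"
proof -
  obtain T where T: "finite T" "T \<subseteq> S"
    "\<And>p. p \<in> S \<Longrightarrow> \<exists>q\<in>T. (\<Sum>z\<in>X. \<bar>measure q {z} - measure p {z}\<bar>) \<le> \<epsilon> / 2"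
    using prob_measures_totally_bounded[OF X S, of "\<epsilon> / 2"] \<open>0 < \<epsilon>\<close> by auto
  have "\<forall>\<^sub>F n in sequentially. \<exists>q\<in>Q n. (\<Sum>z\<in>X. \<bar>measure p {z} - measure q {z}\<bar>) < \<epsilon> / 2" if "p \<in> T" for p
  proof -
    obtain q where q: "\<And>n. q n \<in> Q n" "limitin (weak_topology X) q p sequentially"
      using lim[of p] \<open>p \<in> T\<close> T(2) by blast
    have "(\<lambda>n. measure (q n) {z}) \<longlonglongrightarrow> measure p {z}" if "z \<in> X" for z
      by (rule limitin_weak_topology_singleton[OF q(2) X that])
        (use q(1) Q S T(2) \<open>p \<in> T\<close> in blast)+
    \<comment> \<open>The sum over \<open>X\<close> is finite, so convergence of the point masses is
      convergence in \<open>l1\<close>.\<close>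
    then have "(\<lambda>n. \<Sum>z\<in>X. \<bar>measure p {z} - measure (q n) {z}\<bar>) \<longlonglongrightarrow> (\<Sum>z\<in>X. \<bar>measure p {z} - measure p {z}\<bar>)"
      by (intro tendsto_intros)
    from order_tendstoD(2)[OF this, of "\<epsilon> / 2"]
    have "\<forall>\<^sub>F n in sequentially. (\<Sum>z\<in>X. \<bar>measure p {z} - measure (q n) {z}\<bar>) < \<epsilon> / 2"
      using \<open>0 < \<epsilon>\<close> by simp
    then show ?thesis
      by eventually_elim (use q(1) in blast)
  qed
  then have "\<forall>\<^sub>F n in sequentially. \<forall>p\<in>T. \<exists>q\<in>Q n. (\<Sum>z\<in>X. \<bar>measure p {z} - measure q {z}\<bar>) < \<epsilon> / 2"
    using T(1) by (simp add: eventually_ball_finite)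
  then show ?thesis
  proof (eventually_elim, intro ballI)
    fix n p assume n: "\<forall>p\<in>T. \<exists>q\<in>Q n. (\<Sum>z\<in>X. \<bar>measure p {z} - measure q {z}\<bar>) < \<epsilon> / 2" and "p \<in> S"
    then obtain p' q where p': "(\<Sum>z\<in>X. \<bar>measure p' {z} - measure p {z}\<bar>) \<le> \<epsilon> / 2"
      and q: "q \<in> Q n" "(\<Sum>z\<in>X. \<bar>measure p' {z} - measure q {z}\<bar>) < \<epsilon> / 2"
      using T(3) by meson
    have "(\<Sum>z\<in>X. \<bar>measure p {z} - measure q {z}\<bar>) \<le>
        (\<Sum>z\<in>X. \<bar>measure p' {z} - measure p {z}\<bar> + \<bar>measure p' {z} - measure q {z}\<bar>)"
      by (intro sum_mono) linarith
    also have "\<dots> \<le> \<epsilon>"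
      using p' q(2) by (simp add: sum.distrib)
    finally show "\<exists>q\<in>Q n. (\<Sum>z\<in>X. \<bar>measure p {z} - measure q {z}\<bar>) \<le> \<epsilon>"
      using q(1) by blast
  qed
qed

section \<open>Robust values\<close>

locale robust_mdp =
  fixes X :: "(real ^ 'd) set" and A :: "(real ^ 'm) set"
    and r :: "real ^ 'd \<Rightarrow> real ^ 'm \<Rightarrow> real ^ 'd \<Rightarrow> real" and \<alpha> B :: real
  assumes finite_X: "finite X" and A_nonempty: "A \<noteq> {}" and \<alpha>: "0 < \<alpha>" "\<alpha> < 1" and B_nonneg: "0 \<le> B"
    and r_bound: "\<And>y a z. y \<in> X \<Longrightarrow> a \<in> A \<Longrightarrow> z \<in> X \<Longrightarrow> \<bar>r y a z\<bar> \<le> B"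
begin

abbreviation V :: "(real ^ 'd \<Rightarrow> real ^ 'm \<Rightarrow> (real ^ 'd) measure set) \<Rightarrow> real ^ 'd \<Rightarrow> real" where
  "V \<equiv> robust_value X A r \<alpha>"

text \<open>The hypothesis shared by \<open>P\<close> and every \<open>Pn n\<close>. Nonemptiness
  keeps all infima away from \<open>Inf {}\<close>, which carries no meaning for real
  numbers.\<close>

definition ambiguity :: "(real ^ 'd \<Rightarrow> real ^ 'm \<Rightarrow> (real ^ 'd) measure set) \<Rightarrow> bool" where
  "ambiguity R \<longleftrightarrow> (\<forall>x\<in>X. \<forall>a\<in>A. R x a \<noteq> {} \<and> R x a \<subseteq> prob_measures X)"

lemma ambiguity_prob_measures:
  "ambiguity R \<Longrightarrow> x \<in> X \<Longrightarrow> a \<in> A \<Longrightarrow> p \<in> R x a \<Longrightarrow> p \<in> prob_measures X"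
  unfolding ambiguity_def by blast

definition gain :: "real ^ 'd \<Rightarrow> (nat \<Rightarrow> real ^ 'd \<Rightarrow> real ^ 'm) \<Rightarrow> (nat \<Rightarrow> real ^ 'd \<Rightarrow> (real ^ 'd) measure) \<Rightarrow> real" where
  "gain x a K = (\<integral>\<omega>. (\<Sum>t. \<alpha> ^ t * r (\<omega> t) (a t (\<omega> t)) (\<omega> (Suc t))) \<partial>path_law X x K)"

lemma V_eq: "V R x = (SUP a\<in>policies X A. INF K\<in>kernels X R a. gain x a K)"
  by (simp add: robust_value_def path_laws_def gain_def image_image)

lemma policies_nonempty: "policies X A \<noteq> {}"
  using A_nonempty by (auto simp: policies_def)

lemma policyD: "a \<in> policies X A \<Longrightarrow> y \<in> X \<Longrightarrow> a t y \<in> A"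
  by (auto simp: policies_def)

text \<open>Over a finite state space measurability only asks for probability measures as values on
  \<open>X\<close>. Feasible kernels can therefore be assembled row by row, by independent
  choices.\<close>

lemma kernels_iff:
  assumes "ambiguity R" "a \<in> policies X A"
  shows "K \<in> kernels X R a \<longleftrightarrow> (\<forall>t. \<forall>y\<in>X. K t y \<in> R y (a t y))"
proof -
  have "K t y \<in> space (prob_algebra (state_space X))" if "\<forall>t. \<forall>y\<in>X. K t y \<in> R y (a t y)" "y \<in> X" for t y
    using ambiguity_prob_measures[OF assms(1) that(2) policyD[OF assms(2) that(2), where t=t], of "K t y"] that
    by (simp add: prob_measures_def)
  then show ?thesis
    using finite_X by (auto simp: kernels_def measurable_state_space_finite)
qed

lemma kernels_nonempty:
  assumes "ambiguity R" "a \<in> policies X A"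
  shows "kernels X R a \<noteq> {}"
proof -
  have "(\<lambda>t y. SOME p. p \<in> R y (a t y)) \<in> kernels X R a"
    using assms(1) policyD[OF assms(2)]
    by (auto simp: kernels_iff[OF assms] ambiguity_def some_in_eq)
  then show ?thesis by blast
qed

lemma kernels_finite_chain:
  assumes "ambiguity R" "a \<in> policies X A" "K \<in> kernels X R a" "x \<in> X"
  shows "finite_chain X x K"
proof
  show "K t y \<in> prob_measures X" if "y \<in> X" for t y
    using assms(3) that
    by (auto simp: kernels_iff[OF assms(1,2)] intro: ambiguity_prob_measures[OF assms(1)] policyD[OF assms(2)])
qed (use finite_X assms(4) in auto)

section \<open>Bounds for gains and robust values\<close>

lemma reward_bound:
  "a \<in> policies X A \<Longrightarrow> y \<in> X \<Longrightarrow> z \<in> X \<Longrightarrow> \<bar>\<alpha> ^ t * r y (a t y) z\<bar> \<le> \<alpha> ^ t * B"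
  using \<alpha> by (auto simp: abs_mult intro: mult_left_mono r_bound policyD)

lemma gain_bound:
  assumes "ambiguity R" "a \<in> policies X A" "K \<in> kernels X R a" "x \<in> X"
  shows "\<bar>gain x a K\<bar> \<le> B / (1 - \<alpha>)"
  unfolding gain_def
  using discounted_bound[OF kernels_finite_chain[OF assms] \<alpha>, where g="\<lambda>t y z. \<alpha> ^ t * r y (a t y) z"]
    reward_bound[OF assms(2)] by blast

lemma gain_bdd_below:
  assumes "ambiguity R" "a \<in> policies X A" "x \<in> X"
  shows "bdd_below (gain x a ` kernels X R a)"
  using gain_bound[OF assms(1,2) _ assms(3)]
  by (intro bdd_belowI2[of _ "- (B / (1 - \<alpha>))"]) (simp add: abs_le_iff minus_le_iff)

lemma INF_gain_bound:
  assumes "ambiguity R" "a \<in> policies X A" "x \<in> X"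
  shows "\<bar>INF K\<in>kernels X R a. gain x a K\<bar> \<le> B / (1 - \<alpha>)"
  using kernels_nonempty[OF assms(1,2)] gain_bound[OF assms(1,2) _ assms(3)] by (intro cInf_abs_ge) auto

lemma INF_gain_bdd_above:
  assumes "ambiguity R" "x \<in> X"
  shows "bdd_above ((\<lambda>a. INF K\<in>kernels X R a. gain x a K) ` policies X A)"
  using INF_gain_bound[OF assms(1) _ assms(2)]
  by (intro bdd_aboveI2[of _ _ "B / (1 - \<alpha>)"]) (simp add: abs_le_iff)

lemma V_bound:
  assumes "ambiguity R" "x \<in> X"
  shows "\<bar>V R x\<bar> \<le> B / (1 - \<alpha>)"
  unfolding V_eq
  using policies_nonempty INF_gain_bound[OF assms(1) _ assms(2)] by (intro cSup_abs_le) auto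

text \<open>With fewer kernels available, the infimum for each fixed policy can only grow, and the
  supremum over policies preserves this.\<close>

lemma V_antimono:
  assumes R: "ambiguity R" and S: "ambiguity S" and x: "x \<in> X"
    and sub: "\<And>y a. y \<in> X \<Longrightarrow> a \<in> A \<Longrightarrow> S y a \<subseteq> R y a"
  shows "V R x \<le> V S x"
  unfolding V_eq
proof (rule cSUP_mono[OF policies_nonempty INF_gain_bdd_above[OF S x]], rule bexI)
  fix a assume a: "a \<in> policies X A"
  have "kernels X S a \<subseteq> kernels X R a"
    using sub policyD[OF a] by (auto simp: kernels_iff[OF R a] kernels_iff[OF S a] subset_iff)
  then show "(INF K\<in>kernels X R a. gain x a K) \<le> (INF K\<in>kernels X S a. gain x a K)"
    by (intro cINF_superset_mono kernels_nonempty[OF S a] gain_bdd_below[OF R a x]) auto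
qed

text \<open>Under a fixed policy, each kernel feasible for \<open>R\<close> is shadowed by a
  row-wise \<open>\<epsilon>\<close>-close kernel feasible for \<open>S\<close>, so the two infima
  compare up to the error of \<open>discounted_perturbation\<close>. That error is the same for all
  policies and survives the supremum.\<close>

lemma V_perturbation:
  assumes R: "ambiguity R" and S: "ambiguity S" and x: "x \<in> X"
    and close: "\<And>y a p. y \<in> X \<Longrightarrow> a \<in> A \<Longrightarrow> p \<in> R y a \<Longrightarrow>
      \<exists>q\<in>S y a. (\<Sum>z\<in>X. \<bar>measure p {z} - measure q {z}\<bar>) \<le> \<epsilon>"
  shows "V S x \<le> V R x + B * \<epsilon> / (1 - \<alpha>)\<^sup>2"
proof -
  let ?e = "B * \<epsilon> / (1 - \<alpha>)\<^sup>2"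
  have "(INF K\<in>kernels X S a. gain x a K) - ?e \<le> (INF K\<in>kernels X R a. gain x a K)"
    if a: "a \<in> policies X A" for a
  proof (rule cINF_greatest[OF kernels_nonempty[OF R a]])
    fix K assume K: "K \<in> kernels X R a"
    \<comment> \<open>The shadow kernel is chosen separately for each time and state; for
      \<open>y\<close> outside \<open>X\<close> its value is arbitrary.\<close>
    define L where "L t y = (SOME q. q \<in> S y (a t y) \<and>
      (\<Sum>z\<in>X. \<bar>measure (K t y) {z} - measure q {z}\<bar>) \<le> \<epsilon>)" for t y
    have L: "L t y \<in> S y (a t y)" "(\<Sum>z\<in>X. \<bar>measure (K t y) {z} - measure (L t y) {z}\<bar>) \<le> \<epsilon>"
      if "y \<in> X" for t y
    proof -
      have "K t y \<in> R y (a t y)"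
        using K that by (simp add: kernels_iff[OF R a])
      from someI_ex[OF close[OF that policyD[OF a that] this, unfolded Bex_def]]
      show "L t y \<in> S y (a t y)" "(\<Sum>z\<in>X. \<bar>measure (K t y) {z} - measure (L t y) {z}\<bar>) \<le> \<epsilon>"
        unfolding L_def by blast+
    qed
    have L': "L \<in> kernels X S a"
      using L(1) by (simp add: kernels_iff[OF S a])
    have "\<bar>gain x a K - gain x a L\<bar> \<le> ?e"
      unfolding gain_def
      by (rule discounted_perturbation[OF kernels_finite_chain[OF R a K x] kernels_finite_chain[OF S a L' x]
            \<alpha> B_nonneg, where g="\<lambda>t y z. \<alpha> ^ t * r y (a t y) z"])
        (use reward_bound[OF a] L(2) in auto)
    moreover have "(INF K\<in>kernels X S a. gain x a K) \<le> gain x a L"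
      by (rule cINF_lower[OF gain_bdd_below[OF S a x] L'])
    ultimately show "(INF K\<in>kernels X S a. gain x a K) - ?e \<le> gain x a K"
      by linarith
  qed
  then have "(INF K\<in>kernels X S a. gain x a K) \<le> V R x + ?e" if "a \<in> policies X A" for a
    using cSUP_upper[OF that INF_gain_bdd_above[OF R x]] that by (fastforce simp: V_eq)
  then show ?thesis
    unfolding V_eq[of S] by (rule cSUP_least[OF policies_nonempty])
qed

section \<open>One-stage problems and \<open>robust_Q\<close>\<close>

lemma stage_eq:
  fixes v :: "real ^ 'd \<Rightarrow> real"
  assumes "p \<in> prob_measures X"
  shows "(\<integral>y. r x a y + \<alpha> * v y \<partial>p) = (\<Sum>z\<in>X. (r x a z + \<alpha> * v z) * measure p {z})"
  by (rule integral_finite_state[OF finite_X assms])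

lemma stage_bound:
  assumes "ambiguity R" "x \<in> X" "a \<in> A" "z \<in> X"
  shows "\<bar>r x a z + \<alpha> * V R z\<bar> \<le> B + B / (1 - \<alpha>)"
proof -
  \<comment> \<open>The discount factor is estimated by 1.\<close>
  have "\<bar>\<alpha> * V R z\<bar> \<le> 1 * (B / (1 - \<alpha>))"
    unfolding abs_mult using \<alpha> V_bound[OF assms(1,4)] by (intro mult_mono) auto
  then show ?thesis
    using r_bound[OF assms(2,3,4)] by linarith
qed

lemma stage_bdd_below:
  assumes "ambiguity R" "x \<in> X" "a \<in> A"
  shows "bdd_below ((\<lambda>p. \<integral>y. r x a y + \<alpha> * V R y \<partial>p) ` R x a)"
proof (rule bdd_belowI2)
  fix p assume "p \<in> R x a"
  then have p: "p \<in> prob_measures X"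
    using ambiguity_prob_measures[OF assms] by blast
  have lower: "- (B + B / (1 - \<alpha>)) \<le> r x a z + \<alpha> * V R z" if "z \<in> X" for z
    using stage_bound[OF assms that] by linarith
  have "- (B + B / (1 - \<alpha>)) = (\<Sum>z\<in>X. - (B + B / (1 - \<alpha>)) * measure p {z})"
    using sum_measure_finite_state[OF finite_X p] by (simp flip: sum_distrib_left)
  also have "\<dots> \<le> (\<integral>y. r x a y + \<alpha> * V R y \<partial>p)"
    unfolding stage_eq[OF p] by (intro sum_mono mult_right_mono lower) simp_all
  finally show "- (B + B / (1 - \<alpha>)) \<le> (\<integral>y. r x a y + \<alpha> * V R y \<partial>p)" .
qed

text \<open>Two effects point the same way: the infimum runs over fewer measures, and by
  \<open>V_antimono\<close> the integrand is larger.\<close>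

lemma robust_Q_antimono:
  assumes R: "ambiguity R" and S: "ambiguity S" and x: "x \<in> X" and a: "a \<in> A"
    and sub: "\<And>y a. y \<in> X \<Longrightarrow> a \<in> A \<Longrightarrow> S y a \<subseteq> R y a"
  shows "robust_Q X A r \<alpha> R x a \<le> robust_Q X A r \<alpha> S x a"
  unfolding robust_Q_def
proof (rule cINF_superset_mono)
  show "S x a \<noteq> {}"
    using S x a by (simp add: ambiguity_def)
  show "S x a \<subseteq> R x a"
    by (rule sub[OF x a])
  fix p assume "p \<in> R x a"
  then have p: "p \<in> prob_measures X"
    by (rule ambiguity_prob_measures[OF R x a])
  show "(\<integral>y. r x a y + \<alpha> * V R y \<partial>p) \<le> (\<integral>y. r x a y + \<alpha> * V S y \<partial>p)"
    unfolding stage_eq[OF p] using \<alpha> V_antimono[OF R S _ sub]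
    by (intro sum_mono mult_right_mono add_left_mono mult_left_mono) auto
qed (rule stage_bdd_below[OF R x a])

text \<open>The constant collects two errors: replacing \<open>p\<close> by \<open>q\<close> costs
  the bound of \<open>stage_bound\<close> times \<open>\<epsilon>\<close>, and replacing
  \<open>V R\<close> by \<open>V S\<close> costs \<open>\<alpha>\<close> times the error of
  \<open>V_perturbation\<close>.\<close>

lemma robust_Q_perturbation:
  assumes R: "ambiguity R" and S: "ambiguity S" and x: "x \<in> X" and a: "a \<in> A"
    and close: "\<And>y a p. y \<in> X \<Longrightarrow> a \<in> A \<Longrightarrow> p \<in> R y a \<Longrightarrow>
      \<exists>q\<in>S y a. (\<Sum>z\<in>X. \<bar>measure p {z} - measure q {z}\<bar>) \<le> \<epsilon>"
  shows "robust_Q X A r \<alpha> S x a \<le>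
    robust_Q X A r \<alpha> R x a + (B + B / (1 - \<alpha>) + \<alpha> * B / (1 - \<alpha>)\<^sup>2) * \<epsilon>"
proof -
  let ?E = "\<lambda>T p. \<integral>y. r x a y + \<alpha> * V T y \<partial>p"
  let ?b = "B + B / (1 - \<alpha>)" and ?c = "B * \<epsilon> / (1 - \<alpha>)\<^sup>2"
  have "robust_Q X A r \<alpha> S x a - (?b * \<epsilon> + \<alpha> * ?c) \<le> (INF p\<in>R x a. ?E R p)"
  proof (rule cINF_greatest)
    show "R x a \<noteq> {}"
      using R x a by (simp add: ambiguity_def)
    fix p assume p: "p \<in> R x a"
    obtain q where q: "q \<in> S x a" "(\<Sum>z\<in>X. \<bar>measure p {z} - measure q {z}\<bar>) \<le> \<epsilon>"
      using close[OF x a p] by blast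
    have pq: "p \<in> prob_measures X" "q \<in> prob_measures X"
      by (rule ambiguity_prob_measures[OF R x a p], rule ambiguity_prob_measures[OF S x a q(1)])
    \<comment> \<open>First only the measure changes, with the value function \<open>V R\<close>
      kept.\<close>
    have "?E R q - ?E R p = (\<Sum>z\<in>X. (r x a z + \<alpha> * V R z) * (measure q {z} - measure p {z}))"
      by (simp add: stage_eq[OF pq(1)] stage_eq[OF pq(2)] right_diff_distrib sum_subtractf)
    also have "\<dots> \<le> (\<Sum>z\<in>X. ?b * \<bar>measure p {z} - measure q {z}\<bar>)"
    proof (rule sum_mono)
      fix z assume z: "z \<in> X"
      have "(r x a z + \<alpha> * V R z) * (measure q {z} - measure p {z})
          \<le> \<bar>r x a z + \<alpha> * V R z\<bar> * \<bar>measure p {z} - measure q {z}\<bar>"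
        by (metis abs_ge_self abs_minus_commute abs_mult)
      also have "\<dots> \<le> ?b * \<bar>measure p {z} - measure q {z}\<bar>"
        by (rule mult_right_mono[OF stage_bound[OF R x a z]]) simp
      finally show "(r x a z + \<alpha> * V R z) * (measure q {z} - measure p {z})
          \<le> ?b * \<bar>measure p {z} - measure q {z}\<bar>" .
    qed
    also have "\<dots> \<le> ?b * \<epsilon>"
      unfolding sum_distrib_left[symmetric] using q(2) B_nonneg \<alpha> by (intro mult_left_mono) auto
    finally have "?E R q \<le> ?E R p + ?b * \<epsilon>"
      by simp
    \<comment> \<open>Then only the value function changes, with the measure \<open>q\<close> kept;
      its total mass 1 leaves the uniform error unchanged.\<close>
    moreover have "?E S q \<le> ?E R q + \<alpha> * ?c"
    proof -
      have "?E S q \<le> (\<Sum>z\<in>X. (r x a z + \<alpha> * V R z + \<alpha> * ?c) * measure q {z})"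
        unfolding stage_eq[OF pq(2)]
      proof (intro sum_mono mult_right_mono)
        fix z assume "z \<in> X"
        from mult_left_mono[OF V_perturbation[OF R S this close], of \<alpha>] \<alpha>
        show "r x a z + \<alpha> * V S z \<le> r x a z + \<alpha> * V R z + \<alpha> * ?c"
          by (simp add: distrib_left)
      qed simp
      also have "\<dots> = ?E R q + \<alpha> * ?c * (\<Sum>z\<in>X. measure q {z})"
        unfolding stage_eq[OF pq(2)] sum_distrib_left sum.distrib[symmetric]
        by (simp only: distrib_right)
      finally show ?thesis
        by (simp add: sum_measure_finite_state[OF finite_X pq(2)])
    qed
    moreover have "robust_Q X A r \<alpha> S x a \<le> ?E S q"
      unfolding robust_Q_def by (rule cINF_lower[OF stage_bdd_below[OF S x a] q(1)])
    ultimately show "robust_Q X A r \<alpha> S x a - (?b * \<epsilon> + \<alpha> * ?c) \<le> ?E R p"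
      by linarith
  qed
  then show ?thesis
    unfolding robust_Q_def[of X A r \<alpha> R] by (simp add: algebra_simps)
qed

end

theorem lemma4p2:
  fixes X :: "(real ^ 'd) set" and A :: "(real ^ 'm) set"
    and r :: "real ^ 'd \<Rightarrow> real ^ 'm \<Rightarrow> real ^ 'd \<Rightarrow> real" and \<alpha> :: real
    and P :: "real ^ 'd \<Rightarrow> real ^ 'm \<Rightarrow> (real ^ 'd) measure set"
    and Pn :: "nat \<Rightarrow> real ^ 'd \<Rightarrow> real ^ 'm \<Rightarrow> (real ^ 'd) measure set"
  assumes "finite X" and "X \<noteq> {}" and "finite A" and "A \<noteq> {}"
    and "0 < \<alpha>" and "\<alpha> < 1"
    and "\<And>x a. x \<in> X \<Longrightarrow> a \<in> A \<Longrightarrow> P x a \<subseteq> prob_measures X"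
    and "\<And>x a. x \<in> X \<Longrightarrow> a \<in> A \<Longrightarrow> P x a \<noteq> {}"
    and "\<And>x a. x \<in> X \<Longrightarrow> a \<in> A \<Longrightarrow> compactin (weak_topology X) (P x a)"
    and "upper_hemicontinuous_map (top_of_set (X \<times> A)) (weak_topology X) (\<lambda>(x, a). P x a)"
    and "lower_hemicontinuous_map (top_of_set (X \<times> A)) (weak_topology X) (\<lambda>(x, a). P x a)"
    and "\<And>n x a. x \<in> X \<Longrightarrow> a \<in> A \<Longrightarrow> finite (Pn n x a)"
    and "\<And>n x a. x \<in> X \<Longrightarrow> a \<in> A \<Longrightarrow> Pn n x a \<subseteq> P x a"
    and "\<And>x a p. x \<in> X \<Longrightarrow> a \<in> A \<Longrightarrow> p \<in> P x a \<Longrightarrow>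
           \<exists>q. (\<forall>n. q n \<in> Pn n x a) \<and>
               limitin (weak_topology X) q p sequentially \<and>
               (\<lambda>n. \<integral>y. norm y \<partial>q n) \<longlonglongrightarrow> (\<integral>y. norm y \<partial>p)"
  shows "\<forall>x\<in>X. \<forall>a\<in>A. (\<lambda>n. robust_Q X A r \<alpha> (Pn n) x a) \<longlonglongrightarrow> robust_Q X A r \<alpha> P x a"
proof (intro ballI)
  fix x a assume x: "x \<in> X" and a: "a \<in> A"
  note approx = assms(14)
  have "bdd_above ((\<lambda>(y, b, z). \<bar>r y b z\<bar>) ` (X \<times> A \<times> X))"
    using assms(1,3) by simp
  then obtain B where "\<forall>v\<in>(\<lambda>(y, b, z). \<bar>r y b z\<bar>) ` (X \<times> A \<times> X). v \<le> B"
    unfolding bdd_above_def by blast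
  then have B: "\<bar>r y b z\<bar> \<le> B" if "y \<in> X" "b \<in> A" "z \<in> X" for y b z
    using that by auto
  \<comment> \<open>Nonnegativity is witnessed by
    \<open>\<bar>r x a x\<bar> \<le> B\<close>.\<close>
  then have "0 \<le> B"
    using x a abs_ge_zero order.trans by blast
  interpret robust_mdp X A r \<alpha> B
    using assms(1,4-6) B \<open>0 \<le> B\<close> by unfold_locales auto
  have P: "ambiguity P"
    using assms(7,8) by (auto simp: ambiguity_def)
  \<comment> \<open>The sequence approximating any element of \<open>P y b\<close> has a member in
    every \<open>Pn n y b\<close>.\<close>
  have "Pn n y b \<noteq> {}" if "y \<in> X" "b \<in> A" for n y b
    using assms(8)[OF that] approx[OF that] by blast
  then have Pn: "ambiguity (Pn n)" for n
    using assms(7,13) by (fastforce simp: ambiguity_def)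
  define c where "c = B + B / (1 - \<alpha>) + \<alpha> * B / (1 - \<alpha>)\<^sup>2"
  have "0 \<le> c"
    using \<alpha> \<open>0 \<le> B\<close> by (simp add: c_def)
  show "(\<lambda>n. robust_Q X A r \<alpha> (Pn n) x a) \<longlonglongrightarrow> robust_Q X A r \<alpha> P x a"
  proof (rule tendstoI)
    fix e :: real assume "0 < e"
    \<comment> \<open>The denominator \<open>c + 1\<close> covers \<open>c = 0\<close> and makes
      \<open>c * \<epsilon> < e\<close> strict.\<close>
    define \<epsilon> where "\<epsilon> = e / (c + 1)"
    have \<epsilon>: "0 < \<epsilon>" "c * \<epsilon> < e"
      using \<open>0 < e\<close> \<open>0 \<le> c\<close> by (auto simp: \<epsilon>_def field_simps)
    have "\<forall>\<^sub>F n in sequentially. \<forall>p\<in>P y b. \<exists>q\<in>Pn n y b. (\<Sum>z\<in>X. \<bar>measure p {z} - measure q {z}\<bar>) \<le> \<epsilon>"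
      if "y \<in> X" "b \<in> A" for y b
      using assms(7)[OF that] assms(13)[OF that] approx[OF that] \<epsilon>(1)
      by (intro uniform_approximation[OF assms(1)]) blast+
    \<comment> \<open>Finitely many state-action pairs admit a common threshold for
      \<open>n\<close>, as the comparison of values needs all rows to be close
      simultaneously.\<close>
    then have "\<forall>\<^sub>F n in sequentially. \<forall>y\<in>X. \<forall>b\<in>A. \<forall>p\<in>P y b.
        \<exists>q\<in>Pn n y b. (\<Sum>z\<in>X. \<bar>measure p {z} - measure q {z}\<bar>) \<le> \<epsilon>"
      using assms(1,3) by (simp add: eventually_ball_finite)
    then show "\<forall>\<^sub>F n in sequentially. dist (robust_Q X A r \<alpha> (Pn n) x a) (robust_Q X A r \<alpha> P x a) < e"
    proof eventually_elim
      fix n assume "\<forall>y\<in>X. \<forall>b\<in>A. \<forall>p\<in>P y b.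
        \<exists>q\<in>Pn n y b. (\<Sum>z\<in>X. \<bar>measure p {z} - measure q {z}\<bar>) \<le> \<epsilon>"
      then have "robust_Q X A r \<alpha> (Pn n) x a \<le> robust_Q X A r \<alpha> P x a + c * \<epsilon>"
        unfolding c_def by (intro robust_Q_perturbation[OF P Pn x a]) blast
      \<comment> \<open>The inclusion of \<open>Pn n\<close> in \<open>P\<close> gives the other
        side of the squeeze without any error.\<close>
      moreover have "robust_Q X A r \<alpha> P x a \<le> robust_Q X A r \<alpha> (Pn n) x a"
        by (rule robust_Q_antimono[OF P Pn x a assms(13)])
      ultimately show "dist (robust_Q X A r \<alpha> (Pn n) x a) (robust_Q X A r \<alpha> P x a) < e"
        using \<epsilon>(2) by (simp add: dist_real_def)
    qed
  qed
qed

end
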